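(* Let $\theta\in\left(0,\frac{\sqrt5+1}{2}\right]$, let $\{(s_k,y_k,x_k)\}$ be a sequence generated by the proximal ADMM with stepsize $\theta$, penalty parameter $\beta>0$, self-adjoint positive semidefinite operators $H,G$ and initial point $(s_0,y_0,x_0)$, and for $k\ge1$ let $\tilde x_k=x_{k-1}-\beta(Cy_{k-1}+Ds_k-c)$. Define $$z_{k-1}=(s_{k-1},y_{k-1},x_{k-1}),\quad \tilde z_k=(s_k,y_k,\tilde x_k),\quad \lambda_k=1,\quad \varepsilon_k=0\qquad\forall k\ge1,$$ and, with $\Delta x_k=x_k-x_{k-1}$, $\Delta y_k=y_k-y_{k-1}$, $$\eta_0=\tau_\theta d_0,\qquad \eta_k=[\sigma_\theta-(\theta-1)^2]\frac{\|\Delta x_k\|_{\mathcal X}^2}{2\beta\theta^3}+\frac{\sigma_\theta+\theta-1}{2\theta}\|\Delta y_k\|_{\mathcal Y,G}^2\quad\forall k\ge1.$$ Then the sequence $\{(z_k,\tilde z_k,\lambda_k,\varepsilon_k,\eta_k)\}$ is an instance of the NE-HPE framework for $0\in T(z)$ with Bregman distance $dw$ and input $z_0=(s_0,y_0,x_0)$, $\eta_0$ and $\sigma=\sigma_\theta$. That is, $\sigma_\theta\in[0,1]$, $\eta_k\ge0$ for all $k\ge0$, and for every $k\ge1$ $$\frac1{\lambda_k}\nabla(dw)_{z_k}(z_{k-1})\in T^{[\varepsilon_k]}(\tilde z_k),\qquad (dw)_{z_k}(\tilde z_k)+\lambda_k\varepsilon_k+\eta_k\le\sigma_\theta(dw)_{z_{k-1}}(\tilde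 z_k)+\eta_{k-1}.$$
   Context: Setting. $\mathcal S,\mathcal Y,\mathcal X$ are finite-dimensional real inner product spaces; $f:\mathcal Y\to(-\infty,\infty]$ and $g:\mathcal S\to(-\infty,\infty]$ are proper closed convex functions; $C:\mathcal Y\to\mathcal X$, $D:\mathcal S\to\mathcal X$ are linear operators with adjoints $C^*,D^*$; $c\in\mathcal X$. The problem is $\inf\{f(y)+g(s): Cy+Ds=c\}$. For a self-adjoint positive semidefinite operator $A$ on a space $\mathcal V$, $\|v\|_{\mathcal V,A}=\langle Av,v\rangle_{\mathcal V}^{1/2}$. $\partial$ denotes the convex subdifferential, $f^*,g^*$ the convex conjugates, $\mathrm{ri}$ the relative interior. Let $T(s,y,x)=(\partial g(s)-D^*x)\times(\partial f(y)-C^*x)\times\{Cy+Ds-c\}$ on $\mathcal Z=\mathcal S\times\mathcal Y\times\mathcal X$ (with the product inner product), and let $T^{-1}(0)$ be the set of $(s,y,x)$ with $0\in T(s,y,x)$. For $\varepsilon\ge0$, $T^{[\varepsilon]}(v)=\{v':\langle v'-v_2,v-v_1\rangle\ge-\varepsilon\ \ \forall v_1,\ \forall v_2\in T(v_1)\}$. Standing assumptions: (A1) $T^{-1}(0)\neq\emptyset$; (A2) there exists $x\in\mathcal X$ with $(C^*x,D^*x)\in \mathrm{ri}(\mathrm{dom} f^* )\times\mathrm{ri}(\mathrm{dom} g^* )$. Proximal ADMM. Given $(s_0,y_0,x_0)\in\mathcal S\times\mathcal Y\times\mathcal X$, $\beta>0$, $\theta>0$, and self-adjoint positive semidefinite linear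 operators $H:\mathcal S\to\mathcal S$, $G:\mathcal Y\to\mathcal Y$, for $k=1,2,\dots$: $s_k$ is an optimal solution of $$\min_{s\in\mathcal S}\left\{g(s)-\langle D^*x_{k-1},s\rangle_{\mathcal S}+\tfrac\beta2\|Cy_{k-1}+Ds-c\|_{\mathcal X}^2+\tfrac12\|s-s_{k-1}\|_{\mathcal S,H}^2\right\},$$ $y_k$ is an optimal solution of $$\min_{y\in\mathcal Y}\left\{f(y)-\langle C^*x_{k-1},y\rangle_{\mathcal Y}+\tfrac\beta2\|Cy+Ds_k-c\|_{\mathcal X}^2+\tfrac12\|y-y_{k-1}\|_{\mathcal Y,G}^2\right\},$$ and $x_k=x_{k-1}-\theta\beta[Cy_k+Ds_k-c]$. Bregman distance. $w(s,y,x)=\frac12\|s\|_{\mathcal S,H}^2+\frac12\|y\|_{\mathcal Y,(G+\beta C^*C)}^2+\frac1{2\beta\theta}\|x\|_{\mathcal X}^2$ on $\mathcal Z$, so that for $z=(s,y,x)$, $z'=(s',y',x')$, $$(dw)_z(z')=\tfrac12\|s'-s\|_{\mathcal S,H}^2+\tfrac12\|y'-y\|_{\mathcal Y,(G+\beta C^*C)}^2+\tfrac1{2\beta\theta}\|x'-x\|_{\mathcal X}^2,$$ $$\nabla(dw)_z(z')=\nabla w(z')-\nabla w(z)=\big(H(s'-s),(G+\beta C^*C)(y'-y),(x'-x)/(\beta\theta)\big).$$ NE-HPE framework (here with feasible set $Z=\mathcal Z$): given $z_0\in Z$, $\eta_0\ge0$, $\sigma\in[0,1]$, at every iteration $k\ge1$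 one takes $\lambda_k>0$ and $(\tilde z_k,z_k,\varepsilon_k,\eta_k)\in Z\times Z\times\mathbb R_+\times\mathbb R_+$ such that $\frac1{\lambda_k}\nabla(dw)_{z_k}(z_{k-1})\in T^{[\varepsilon_k]}(\tilde z_k)$ and $(dw)_{z_k}(\tilde z_k)+\lambda_k\varepsilon_k+\eta_k\le\sigma(dw)_{z_{k-1}}(\tilde z_k)+\eta_{k-1}$. Constants: $$d_0=\inf_{(s,y,x)\in T^{-1}(0)}\left\{\tfrac12\|s_0-s\|_{\mathcal S,H}^2+\tfrac12\|y_0-y\|_{\mathcal Y,(G+\beta C^*C)}^2+\tfrac1{2\beta\theta}\|x_0-x\|_{\mathcal X}^2\right\},$$ $$\sigma_\theta=\frac{3\theta^2-7\theta+5+\sqrt{(3\theta^2-7\theta+5)^2-4(2-\theta)(3-\theta)(\theta-1)^2}}{2(3-\theta)},\qquad \tau_\theta=4\max\left\{\frac1{\sqrt\theta},\frac{\sqrt\theta}{2-\theta}\right\}.$$ *)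

theory Defs
  imports "HOL-Analysis.Analysis"
begin

section \<open>Extended-real-valued convex functions\<close>

definition proper_fun :: "('a \<Rightarrow> ereal) \<Rightarrow> bool" where
  "proper_fun f \<longleftrightarrow> (\<forall>x. f x \<noteq> -\<infinity>) \<and> (\<exists>x. f x \<noteq> \<infinity>)"

text \<open>The library's \<open>epigraph\<close> only covers real-valued functions.\<close>

definition ereal_epigraph :: "('a \<Rightarrow> ereal) \<Rightarrow> ('a \<times> real) set" where
  "ereal_epigraph f = {(x, r). f x \<le> ereal r}"

definition convex_fun :: "('a::real_vector \<Rightarrow> ereal) \<Rightarrow> bool" where
  "convex_fun f \<longleftrightarrow> convex (ereal_epigraph f)"

definition closed_fun :: "('a::topological_space \<Rightarrow> ereal) \<Rightarrow> bool" where
  "closed_fun f \<longleftrightarrow> closed (ereal_epigraph f)"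

definition edomain :: "('a \<Rightarrow> ereal) \<Rightarrow> 'a set" where
  "edomain f = {x. f x < \<infinity>}"

definition conjugate :: "('a::real_inner \<Rightarrow> ereal) \<Rightarrow> 'a \<Rightarrow> ereal" where
  "conjugate f u = (SUP x. ereal (u \<bullet> x) - f x)"

definition subdifferential :: "('a::real_inner \<Rightarrow> ereal) \<Rightarrow> 'a \<Rightarrow> 'a set" where
  "subdifferential f x = {u. \<forall>y. f x + ereal (u \<bullet> (y - x)) \<le> f y}"

lemma subdifferential_outside_domain:
  assumes "proper_fun f" and "x \<notin> edomain f"
  shows "subdifferential f x = {}"
  using assms by (auto simp: proper_fun_def edomain_def subdifferential_def)

definition is_minimizer :: "('a \<Rightarrow> ereal) \<Rightarrow> 'a \<Rightarrow> bool" where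
  "is_minimizer h x \<longleftrightarrow> (\<forall>u. h x \<le> h u)"


section \<open>Positive semidefinite operators and their seminorms\<close>

definition psd_op :: "('a::real_inner \<Rightarrow> 'a) \<Rightarrow> bool" where
  "psd_op A \<longleftrightarrow> linear A \<and> adjoint A = A \<and> (\<forall>v. 0 \<le> A v \<bullet> v)"

definition op_seminorm :: "('a::real_inner \<Rightarrow> 'a) \<Rightarrow> 'a \<Rightarrow> real" where
  "op_seminorm A v = sqrt (A v \<bullet> v)"


section \<open>Set-valued operators, Bregman distances and the NE-HPE framework\<close>

definition zeros :: "('z::zero \<Rightarrow> 'z set) \<Rightarrow> 'z set" where
  "zeros T = {z. 0 \<in> T z}"

definition enlargement :: "('z::real_inner \<Rightarrow> 'z set) \<Rightarrow> real \<Rightarrow> 'z \<Rightarrow> 'z set" where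
  "enlargement T \<epsilon> v = {v'. \<forall>v\<^sub>1. \<forall>v\<^sub>2 \<in> T v\<^sub>1. (v' - v\<^sub>2) \<bullet> (v - v\<^sub>1) \<ge> - \<epsilon>}"

text \<open>The gradient as a function; meaningful only where a gradient exists.\<close>

definition gradient :: "('z::real_inner \<Rightarrow> real) \<Rightarrow> 'z \<Rightarrow> 'z" where
  "gradient h z = (THE D. GDERIV h z :> D)"

text \<open>\<open>bregman w z z'\<close> is $(dw)_z(z')$: the base point comes first, and gradients of the
  distance are taken in the second argument.\<close>

definition bregman :: "('z::real_inner \<Rightarrow> real) \<Rightarrow> 'z \<Rightarrow> 'z \<Rightarrow> real" where
  "bregman w z z' = w z' - w z - gradient w z \<bullet> (z' - z)"

text \<open>The feasible set is the whole space. Sequences are indexed from 0 and the entries of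
  \<open>zt\<close>, \<open>lam\<close> and \<open>eps\<close> at index 0 are irrelevant.\<close>

definition NE_HPE_instance ::
  "('z::real_inner \<Rightarrow> 'z set) \<Rightarrow> ('z \<Rightarrow> real) \<Rightarrow> 'z \<Rightarrow> real \<Rightarrow> real \<Rightarrow>
   (nat \<Rightarrow> 'z) \<Rightarrow> (nat \<Rightarrow> 'z) \<Rightarrow> (nat \<Rightarrow> real) \<Rightarrow> (nat \<Rightarrow> real) \<Rightarrow> (nat \<Rightarrow> real) \<Rightarrow> bool" where
  "NE_HPE_instance T w z\<^sub>0 \<eta>\<^sub>0 \<sigma> z zt lam eps eta \<longleftrightarrow>
     0 \<le> \<sigma> \<and> \<sigma> \<le> 1 \<and> 0 \<le> \<eta>\<^sub>0 \<and> z 0 = z\<^sub>0 \<and> eta 0 = \<eta>\<^sub>0 \<and>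
     (\<forall>k\<ge>1. lam k > 0 \<and> eps k \<ge> 0 \<and> eta k \<ge> 0 \<and>
        (1 / lam k) *\<^sub>R gradient (bregman w (z k)) (z (k - 1)) \<in> enlargement T (eps k) (zt k) \<and>
        bregman w (z k) (zt k) + lam k * eps k + eta k
          \<le> \<sigma> * bregman w (z (k - 1)) (zt k) + eta (k - 1))"


section \<open>The proximal ADMM\<close>

definition admm_T ::
  "('y::real_inner \<Rightarrow> ereal) \<Rightarrow> ('s::real_inner \<Rightarrow> ereal) \<Rightarrow> ('y \<Rightarrow> 'x::real_inner) \<Rightarrow> ('s \<Rightarrow> 'x) \<Rightarrow> 'x \<Rightarrow>
   's \<times> 'y \<times> 'x \<Rightarrow> ('s \<times> 'y \<times> 'x) set" where
  "admm_T f g C D c = (\<lambda>(s, y, x).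
     ((\<lambda>u. u - adjoint D x) ` subdifferential g s) \<times>
     ((\<lambda>v. v - adjoint C x) ` subdifferential f y) \<times>
     {C y + D s - c})"

definition y_weight :: "('y::real_inner \<Rightarrow> 'y) \<Rightarrow> ('y \<Rightarrow> 'x::real_inner) \<Rightarrow> real \<Rightarrow> 'y \<Rightarrow> 'y" where
  "y_weight G C \<beta> = (\<lambda>y. G y + \<beta> *\<^sub>R adjoint C (C y))"

definition admm_w ::
  "('s::real_inner \<Rightarrow> 's) \<Rightarrow> ('y::real_inner \<Rightarrow> 'y) \<Rightarrow> ('y \<Rightarrow> 'x::real_inner) \<Rightarrow> real \<Rightarrow> real \<Rightarrow>
   's \<times> 'y \<times> 'x \<Rightarrow> real" where
  "admm_w H G C \<beta> \<theta> = (\<lambda>(s, y, x).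
     1/2 * (op_seminorm H s)\<^sup>2 + 1/2 * (op_seminorm (y_weight G C \<beta>) y)\<^sup>2
     + 1 / (2 * \<beta> * \<theta>) * (norm x)\<^sup>2)"

definition proximal_admm ::
  "('y::real_inner \<Rightarrow> ereal) \<Rightarrow> ('s::real_inner \<Rightarrow> ereal) \<Rightarrow> ('y \<Rightarrow> 'x::real_inner) \<Rightarrow> ('s \<Rightarrow> 'x) \<Rightarrow> 'x \<Rightarrow>
   ('s \<Rightarrow> 's) \<Rightarrow> ('y \<Rightarrow> 'y) \<Rightarrow> real \<Rightarrow> real \<Rightarrow> 's \<Rightarrow> 'y \<Rightarrow> 'x \<Rightarrow>
   (nat \<Rightarrow> 's) \<Rightarrow> (nat \<Rightarrow> 'y) \<Rightarrow> (nat \<Rightarrow> 'x) \<Rightarrow> bool" where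
  "proximal_admm f g C D c H G \<beta> \<theta> s\<^sub>0 y\<^sub>0 x\<^sub>0 s y x \<longleftrightarrow>
     s 0 = s\<^sub>0 \<and> y 0 = y\<^sub>0 \<and> x 0 = x\<^sub>0 \<and>
     (\<forall>k\<ge>1.
        is_minimizer (\<lambda>u. g u + ereal (
            - (adjoint D (x (k - 1)) \<bullet> u)
            + \<beta> / 2 * (norm (C (y (k - 1)) + D u - c))\<^sup>2
            + 1/2 * (op_seminorm H (u - s (k - 1)))\<^sup>2)) (s k) \<and>
        is_minimizer (\<lambda>v. f v + ereal (
            - (adjoint C (x (k - 1)) \<bullet> v)
            + \<beta> / 2 * (norm (C v + D (s k) - c))\<^sup>2
            + 1/2 * (op_seminorm G (v - y (k - 1)))\<^sup>2)) (y k) \<and>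
        x k = x (k - 1) - (\<theta> * \<beta>) *\<^sub>R (C (y k) + D (s k) - c))"

definition admm_d0 ::
  "('y::real_inner \<Rightarrow> ereal) \<Rightarrow> ('s::real_inner \<Rightarrow> ereal) \<Rightarrow> ('y \<Rightarrow> 'x::real_inner) \<Rightarrow> ('s \<Rightarrow> 'x) \<Rightarrow> 'x \<Rightarrow>
   ('s \<Rightarrow> 's) \<Rightarrow> ('y \<Rightarrow> 'y) \<Rightarrow> real \<Rightarrow> real \<Rightarrow> 's \<Rightarrow> 'y \<Rightarrow> 'x \<Rightarrow> real" where
  "admm_d0 f g C D c H G \<beta> \<theta> s\<^sub>0 y\<^sub>0 x\<^sub>0 =
     (INF (s, y, x) \<in> zeros (admm_T f g C D c).
        1/2 * (op_seminorm H (s\<^sub>0 - s))\<^sup>2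
        + 1/2 * (op_seminorm (y_weight G C \<beta>) (y\<^sub>0 - y))\<^sup>2
        + 1 / (2 * \<beta> * \<theta>) * (norm (x\<^sub>0 - x))\<^sup>2)"

definition sigma_theta :: "real \<Rightarrow> real" where
  "sigma_theta \<theta> =
     (3 * \<theta>\<^sup>2 - 7 * \<theta> + 5
       + sqrt ((3 * \<theta>\<^sup>2 - 7 * \<theta> + 5)\<^sup>2 - 4 * (2 - \<theta>) * (3 - \<theta>) * (\<theta> - 1)\<^sup>2))
     / (2 * (3 - \<theta>))"

definition tau_theta :: "real \<Rightarrow> real" where
  "tau_theta \<theta> = 4 * max (1 / sqrt \<theta>) (sqrt \<theta> / (2 - \<theta>))"


section \<open>The Bregman distance in closed form\<close>

lemma gradient_eqI:
  assumes "GDERIV h z :> D"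
  shows "gradient h z = D"
  unfolding gradient_def
proof (rule the_equality)
  show "GDERIV h z :> D" by (rule assms)
next
  fix E assume "GDERIV h z :> E"
  with assms have "(\<lambda>k. k \<bullet> E) = (\<lambda>k. k \<bullet> D)"
    unfolding gderiv_def by (rule has_derivative_unique[rotated])
  then have "k \<bullet> (E - D) = 0" for k
    by (metis inner_diff_right right_minus_eq)
  then show "E = D"
    by (metis inner_eq_zero_iff right_minus_eq)
qed

lemma psd_op_inner_swap:
  fixes A :: "'a::euclidean_space \<Rightarrow> 'a"
  assumes "psd_op A"
  shows "A u \<bullet> v = u \<bullet> A v"
  using assms adjoint_works[of A v u] by (simp add: psd_op_def inner_commute)

lemma op_seminorm_square: "psd_op A \<Longrightarrow> (op_seminorm A v)\<^sup>2 = A v \<bullet> v"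
  by (simp add: op_seminorm_def psd_op_def)

lemma psd_op_y_weight:
  fixes G :: "'y::euclidean_space \<Rightarrow> 'y" and C :: "'y \<Rightarrow> 'x::euclidean_space"
  assumes G: "psd_op G" and C: "linear C" and \<beta>: "\<beta> > 0"
  shows "psd_op (y_weight G C \<beta>)"
proof -
  have linG: "linear G" using G by (simp add: psd_op_def)
  have lin: "linear (y_weight G C \<beta>)"
    unfolding y_weight_def
    using linear_compose[OF C adjoint_linear[OF C]] linG
    by (intro linear_compose_add linear_compose_scale_right) (auto simp: o_def)
  have sym: "y_weight G C \<beta> u \<bullet> v = u \<bullet> y_weight G C \<beta> v" for u v
    using psd_op_inner_swap[OF G, of u v] adjoint_works[OF C, of v "C u"] adjoint_works[OF C, of u "C v"]
    by (simp add: y_weight_def inner_add_left inner_add_right inner_commute)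
  have "0 \<le> y_weight G C \<beta> v \<bullet> v" for v
    using G \<beta> adjoint_works[OF C, of v "C v"]
    by (simp add: y_weight_def inner_add_left inner_add_right inner_commute psd_op_def)
  then show ?thesis
    using lin adjoint_unique[of "y_weight G C \<beta>" "y_weight G C \<beta>"] sym by (simp add: psd_op_def)
qed

lemma admm_w_gderiv:
  fixes H :: "'s::euclidean_space \<Rightarrow> 's" and G :: "'y::euclidean_space \<Rightarrow> 'y"
    and C :: "'y \<Rightarrow> 'x::euclidean_space"
  assumes H: "psd_op H" and G: "psd_op G" and C: "linear C" and "\<beta> > 0"
  shows "GDERIV (admm_w H G C \<beta> \<theta>) (s, y, x) :> (H s, y_weight G C \<beta> y, (1 / (\<beta> * \<theta>)) *\<^sub>R x)"
proof -
  define W where "W = y_weight G C \<beta>"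
  have W: "psd_op W" unfolding W_def using psd_op_y_weight assms by blast
  have w: "admm_w H G C \<beta> \<theta> = (\<lambda>z. 1/2 * (H (fst z) \<bullet> fst z) + 1/2 * (W (fst (snd z)) \<bullet> fst (snd z))
      + 1 / (2 * \<beta> * \<theta>) * (snd (snd z) \<bullet> snd (snd z)))"
    by (auto simp: admm_w_def W_def[symmetric] op_seminorm_square[OF H] op_seminorm_square[OF W]
        power2_norm_eq_inner)
  have dH: "(H has_derivative H) F" for F
    using H by (simp add: psd_op_def linear_imp_has_derivative)
  have dW: "(W has_derivative W) F" for F
    using W by (simp add: psd_op_def linear_imp_has_derivative)
  show ?thesis
    unfolding gderiv_def w W_def[symmetric]
    apply (rule has_derivative_eq_rhs)
     apply (rule derivative_intros has_derivative_compose[OF _ dH] has_derivative_compose[OF _ dW])+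
    using psd_op_inner_swap[OF H, of s] psd_op_inner_swap[OF W, of y]
    apply (auto simp: fun_eq_iff inner_commute field_simps)
    done
qed

lemma bregman_admm_w:
  fixes H :: "'s::euclidean_space \<Rightarrow> 's" and G :: "'y::euclidean_space \<Rightarrow> 'y"
    and C :: "'y \<Rightarrow> 'x::euclidean_space"
  assumes H: "psd_op H" and G: "psd_op G" and C: "linear C" and "\<beta> > 0"
  shows "bregman (admm_w H G C \<beta> \<theta>) (s, y, x) (s', y', x') =
     1/2 * (op_seminorm H (s' - s))\<^sup>2 + 1/2 * (op_seminorm (y_weight G C \<beta>) (y' - y))\<^sup>2
     + 1 / (2 * \<beta> * \<theta>) * (norm (x' - x))\<^sup>2"
proof -
  define W where "W = y_weight G C \<beta>"
  have W: "psd_op W" unfolding W_def using psd_op_y_weight assms by blast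
  have lin: "H (s' - s) = H s' - H s" "W (y' - y) = W y' - W y"
    using H W by (auto simp: psd_op_def linear_diff)
  have sym: "H s' \<bullet> s = H s \<bullet> s'" "W y' \<bullet> y = W y \<bullet> y'"
    using psd_op_inner_swap[OF H, of s' s] psd_op_inner_swap[OF W, of y' y] by (simp_all add: inner_commute)
  have grad: "gradient (admm_w H G C \<beta> \<theta>) (s, y, x) = (H s, W y, (1 / (\<beta> * \<theta>)) *\<^sub>R x)"
    unfolding W_def using admm_w_gderiv[OF assms] by (rule gradient_eqI)
  have x: "1 / (2 * \<beta> * \<theta>) * a = (1 / (\<beta> * \<theta>)) * (a / 2)" for a by simp
  show ?thesis
    unfolding bregman_def grad
    unfolding admm_w_def W_def[symmetric] prod.case x
      op_seminorm_square[OF H] op_seminorm_square[OF W] power2_norm_eq_inner lin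
    using sym by (simp add: inner_diff_left inner_diff_right inner_commute[of x' x] diff_divide_distrib
        add_divide_distrib distrib_left right_diff_distrib)
qed

lemma gradient_bregman_admm_w:
  fixes H :: "'s::euclidean_space \<Rightarrow> 's" and G :: "'y::euclidean_space \<Rightarrow> 'y"
    and C :: "'y \<Rightarrow> 'x::euclidean_space"
  assumes "psd_op H" and "psd_op G" and "linear C" and "\<beta> > 0"
  shows "gradient (bregman (admm_w H G C \<beta> \<theta>) (s, y, x)) (s', y', x') =
     (H (s' - s), y_weight G C \<beta> (y' - y), (1 / (\<beta> * \<theta>)) *\<^sub>R (x' - x))"
proof (rule gradient_eqI)
  let ?w = "admm_w H G C \<beta> \<theta>"
  have 1: "GDERIV ?w (s', y', x') :> (H s', y_weight G C \<beta> y', (1 / (\<beta> * \<theta>)) *\<^sub>R x')"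
    by (rule admm_w_gderiv[OF assms])
  have 2: "gradient ?w (s, y, x) = (H s, y_weight G C \<beta> y, (1 / (\<beta> * \<theta>)) *\<^sub>R x)"
    by (rule gradient_eqI[OF admm_w_gderiv[OF assms]])
  have lin: "H (s' - s) = H s' - H s"
      "y_weight G C \<beta> (y' - y) = y_weight G C \<beta> y' - y_weight G C \<beta> y"
    using assms psd_op_y_weight[OF assms(2-4)] by (auto simp: psd_op_def linear_diff)
  have 3: "((\<lambda>z. gradient ?w (s, y, x) \<bullet> (z - (s, y, x))) has_derivative
      (\<lambda>h. gradient ?w (s, y, x) \<bullet> h)) (at (s', y', x'))"
    by (auto intro!: derivative_eq_intros)
  have "(bregman ?w (s, y, x) has_derivative
      (\<lambda>h. h \<bullet> (H s', y_weight G C \<beta> y', (1 / (\<beta> * \<theta>)) *\<^sub>R x') - 0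
           - gradient ?w (s, y, x) \<bullet> h)) (at (s', y', x'))"
    unfolding bregman_def
    by (intro has_derivative_diff has_derivative_const 3 1[unfolded gderiv_def])
  then show "GDERIV (bregman ?w (s, y, x)) (s', y', x') :>
      (H (s' - s), y_weight G C \<beta> (y' - y), (1 / (\<beta> * \<theta>)) *\<^sub>R (x' - x))"
    unfolding gderiv_def 2 lin
    by (rule has_derivative_eq_rhs)
      (auto simp: fun_eq_iff inner_diff_right inner_diff_left inner_commute scaleR_diff_right right_diff_distrib)
qed

end

theory Submission
  imports Defs
begin

text \<open>Optimality in the two subproblems shows that $\nabla(dw)_{z_k}(z_{k-1})$ lies in
  $T(\tilde z_k)$ itself, and $T$ is monotone. The differences $\tilde x_k - x_{k-1}$ and
  $\tilde x_k - x_k$ are combinations of $\Delta x_k$ and $C\Delta y_k$, so the error condition is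
  a quadratic inequality in $\Delta x_k$, $C\Delta y_k$, $\Delta y_k$, $\Delta s_k$ whose
  problematic term is $\langle \Delta x_k, C\Delta y_k\rangle$.
  For $k \ge 2$, monotonicity of $\partial f$ between $y_{k-1}$ and $y_k$ replaces $\Delta x_k$ in it
  by $\Delta x_{k-1}$, whose square is available in $\eta_{k-1}$; the resulting form is positive
  semidefinite because $\sigma_\theta$ makes its determinant vanish.
  For $k = 1$, the increments are bounded by the distances of $z_0$ and $z_1$ to a zero $z'$ of $T$,
  and the three-point identity bounds the second distance by the first.\<close>

section \<open>Monotonicity of the ADMM operator\<close>

lemma subdifferential_monotone:
  assumes "proper_fun f" "u \<in> subdifferential f x" "v \<in> subdifferential f y"
  shows "0 \<le> (u - v) \<bullet> (x - y)"
proof -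
  \<comment> \<open>Finiteness of both values is what lets them cancel when the two subgradient
    inequalities are added.\<close>
  have "x \<in> edomain f" "y \<in> edomain f"
    using subdifferential_outside_domain assms by blast+
  with assms(1) obtain p q where p: "f x = ereal p" and q: "f y = ereal q"
    by (cases "f x"; cases "f y") (auto simp: proper_fun_def edomain_def)
  have "f x + ereal (u \<bullet> (y - x)) \<le> f y" "f y + ereal (v \<bullet> (x - y)) \<le> f x"
    using assms(2,3) by (auto simp: subdifferential_def)
  then have "p + u \<bullet> (y - x) \<le> q" "q + v \<bullet> (x - y) \<le> p"
    by (simp_all add: p q)
  then show ?thesis
    by (simp add: inner_diff_left inner_diff_right)
qed

text \<open>The linear part of the operator is skew: the terms from \<open>adjoint C\<close>,
  \<open>adjoint D\<close> and the constraint cancel in the inner product, leaving only the two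
  monotone subdifferentials.\<close>

lemma admm_T_monotone:
  fixes f :: "'y::euclidean_space \<Rightarrow> ereal" and g :: "'s::euclidean_space \<Rightarrow> ereal"
    and C :: "'y \<Rightarrow> 'x::euclidean_space"
  assumes f: "proper_fun f" and g: "proper_fun g" and C: "linear C" and D: "linear D"
    and "v \<in> admm_T f g C D c z" and "v' \<in> admm_T f g C D c z'"
  shows "0 \<le> (v - v') \<bullet> (z - z')"
proof -
  obtain s y x s' y' x' where z: "z = (s, y, x)" "z' = (s', y', x')"
    by (metis prod.exhaust)
  obtain u p u' p' where u: "u \<in> subdifferential g s" "u' \<in> subdifferential g s'"
      and p: "p \<in> subdifferential f y" "p' \<in> subdifferential f y'"
      and v: "v = (u - adjoint D x, p - adjoint C x, C y + D s - c)"
        "v' = (u' - adjoint D x', p' - adjoint C x', C y' + D s' - c)"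
    using assms(5,6) by (auto simp: admm_T_def z)
  have "adjoint D w \<bullet> t = w \<bullet> D t" for w t
    using adjoint_works[OF D, of t w] by (simp add: inner_commute)
  moreover have "adjoint C w \<bullet> t = w \<bullet> C t" for w t
    using adjoint_works[OF C, of t w] by (simp add: inner_commute)
  ultimately have "(v - v') \<bullet> (z - z') = (u - u') \<bullet> (s - s') + (p - p') \<bullet> (y - y')"
    by (simp add: z v inner_diff_left inner_diff_right linear_diff[OF C] linear_diff[OF D]
        inner_commute[of "C _"] inner_commute[of "D _"] inner_add_left inner_add_right)
  then show ?thesis
    using subdifferential_monotone[OF g u] subdifferential_monotone[OF f p] by simp
qed

section \<open>Optimality conditions of the subproblems\<close>

text \<open>On the segment from \<open>y\<close> to \<open>v\<close>, convexity bounds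
  \<open>f\<close> by its chord. Chord plus \<open>q\<close> still has its minimum over [0, 1] at 0,
  so its derivative there is nonnegative, which is the subgradient inequality.\<close>

lemma minimizer_gderiv_subdifferential:
  fixes f :: "'a::real_inner \<Rightarrow> ereal"
  assumes f: "proper_fun f" "convex_fun f"
    and min: "is_minimizer (\<lambda>v. f v + ereal (q v)) y"
    and q: "GDERIV q y :> p"
  shows "- p \<in> subdifferential f y"
proof -
  obtain v0 a0 where "f v0 = ereal a0"
    using f(1) unfolding proper_fun_def by (metis ereal_cases)
  \<comment> \<open>The objective at \<open>y\<close> is at most its finite value at
    \<open>v0\<close>, so \<open>f y\<close> is finite.\<close>
  with min f(1) obtain a where a: "f y = ereal a"
    unfolding is_minimizer_def proper_fun_def
    by (metis PInfty_neq_ereal(1) ereal_cases ereal_infty_less_eq(1) plus_ereal.simps(1,2))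
  have "f y + ereal (- p \<bullet> (v - y)) \<le> f v" for v
  proof (cases "f v")
    case (real b)
    define \<phi> where "\<phi> t = t * (b - a) + q (y + t *\<^sub>R (v - y))" for t
    have \<phi>: "\<phi> 0 \<le> \<phi> t" if t: "0 \<le> t" "t \<le> 1" for t
    proof -
      have "(y, a) \<in> ereal_epigraph f" "(v, b) \<in> ereal_epigraph f"
        by (auto simp: ereal_epigraph_def a real)
      then have "(1 - t) *\<^sub>R (y, a) + t *\<^sub>R (v, b) \<in> ereal_epigraph f"
        using f(2) t unfolding convex_fun_def by (intro convexD) auto
      then have "f (y + t *\<^sub>R (v - y)) \<le> ereal (a + t * (b - a))"
        by (simp add: ereal_epigraph_def algebra_simps)
      moreover have "f y + ereal (q y) \<le> f (y + t *\<^sub>R (v - y)) + ereal (q (y + t *\<^sub>R (v - y)))"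
        using min by (auto simp: is_minimizer_def)
      ultimately show ?thesis
        by (cases "f (y + t *\<^sub>R (v - y))") (auto simp: \<phi>_def a)
    qed
    have D: "DERIV \<phi> 0 :> (b - a) + p \<bullet> (v - y)"
    proof -
      have d: "((\<lambda>t. y + t *\<^sub>R (v - y)) has_derivative (\<lambda>t. t *\<^sub>R (v - y))) (at (0::real))"
        by (auto intro!: derivative_eq_intros)
      have "(q has_derivative (\<lambda>h. h \<bullet> p)) (at (y + 0 *\<^sub>R (v - y)))"
        using q by (simp add: gderiv_def)
      from has_derivative_compose[OF d this]
      have "((\<lambda>t. q (y + t *\<^sub>R (v - y))) has_derivative (\<lambda>t. (p \<bullet> (v - y)) * t)) (at 0)"
        by (simp add: inner_commute mult.commute)
      then have "DERIV (\<lambda>t. q (y + t *\<^sub>R (v - y))) 0 :> p \<bullet> (v - y)"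
        by (simp add: has_field_derivative_def)
      then show ?thesis
        unfolding \<phi>_def by (auto intro!: derivative_eq_intros)
    qed
    have "0 \<le> (b - a) + p \<bullet> (v - y)"
    proof (rule ccontr, unfold not_le)
      assume "(b - a) + p \<bullet> (v - y) < 0"
      from DERIV_neg_dec_right[OF D this]
      obtain d where "d > 0" and d: "\<And>h. 0 < h \<Longrightarrow> h < d \<Longrightarrow> \<phi> h < \<phi> 0"
        by auto
      from \<open>d > 0\<close> have "\<phi> (min 1 (d / 2)) < \<phi> 0"
        by (intro d) auto
      with \<phi>[of "min 1 (d / 2)"] \<open>d > 0\<close>
      show False by auto
    qed
    then show ?thesis
      by (simp add: a real)
  qed (use f(1) in \<open>auto simp: proper_fun_def\<close>)
  then show ?thesis
    by (simp add: subdifferential_def)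
qed

text \<open>Serves both subproblems: \<open>e\<close> collects \<open>c\<close> and the contribution
  of the variable held fixed.\<close>

lemma proximal_minimizer_subdifferential:
  fixes f :: "'a::euclidean_space \<Rightarrow> ereal" and L :: "'a \<Rightarrow> 'b::euclidean_space"
  assumes f: "proper_fun f" "convex_fun f" and L: "linear L" and P: "psd_op P"
    and min: "is_minimizer (\<lambda>u. f u + ereal (- (l \<bullet> u) + \<beta> / 2 * (norm (L u + e))\<^sup>2
                + 1/2 * (op_seminorm P (u - v))\<^sup>2)) u"
  shows "l - \<beta> *\<^sub>R adjoint L (L u + e) - P (u - v) \<in> subdifferential f u"
proof -
  have dL: "(L has_derivative L) F" for F
    using L by (simp add: linear_imp_has_derivative)
  have dP: "(P has_derivative P) F" for F
    using P by (simp add: psd_op_def linear_imp_has_derivative)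
  have swapP: "P t \<bullet> (u - v) = t \<bullet> P (u - v)" "P (u - v) \<bullet> t = t \<bullet> P (u - v)" for t
    using psd_op_inner_swap[OF P, of t "u - v"] by (simp_all add: inner_commute)
  have swapL: "L t \<bullet> (L u + e) = t \<bullet> adjoint L (L u + e)" "(L u + e) \<bullet> L t = t \<bullet> adjoint L (L u + e)" for t
    using adjoint_works[OF L, of t "L u + e"] by (simp_all add: inner_commute)
  have "GDERIV (\<lambda>u. - (l \<bullet> u) + \<beta> / 2 * (norm (L u + e))\<^sup>2 + 1/2 * (op_seminorm P (u - v))\<^sup>2) u
      :> - l + \<beta> *\<^sub>R adjoint L (L u + e) + P (u - v)"
    unfolding gderiv_def op_seminorm_square[OF P] power2_norm_eq_inner
    apply (rule has_derivative_eq_rhs)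
     apply (rule derivative_intros has_derivative_compose[OF _ dL] has_derivative_compose[OF _ dP])+
    apply (simp add: fun_eq_iff swapP swapL inner_commute[of l])
    apply (simp add: inner_add_right inner_diff_right)
    done
  from minimizer_gderiv_subdifferential[OF f min this] show ?thesis
    by (simp add: algebra_simps)
qed

section \<open>Inequalities for seminorms and quadratic forms\<close>

lemma psd_op_inner_bound:
  fixes A :: "'a::euclidean_space \<Rightarrow> 'a"
  assumes "psd_op A"
  shows "2 * (A u \<bullet> v) \<le> (op_seminorm A u)\<^sup>2 + (op_seminorm A v)\<^sup>2"
proof -
  have "linear A" "0 \<le> A (u - v) \<bullet> (u - v)" using assms by (simp_all add: psd_op_def)
  moreover have "A v \<bullet> u = A u \<bullet> v"
    using psd_op_inner_swap[OF assms, of u v] by (simp add: inner_commute)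
  ultimately show ?thesis
    by (simp add: op_seminorm_square[OF assms] linear_diff inner_diff_left inner_diff_right)
qed

text \<open>By the parallelogram identity the two sides differ by the squared seminorm of
  \<open>u + v - 2 *\<^sub>R w\<close>.\<close>

lemma op_seminorm_diff_square_le:
  fixes A :: "'a::euclidean_space \<Rightarrow> 'a"
  assumes "psd_op A"
  shows "(op_seminorm A (u - v))\<^sup>2 \<le> 2 * (op_seminorm A (w - u))\<^sup>2 + 2 * (op_seminorm A (w - v))\<^sup>2"
proof -
  have "linear A" "0 \<le> A (u + v - 2 *\<^sub>R w) \<bullet> (u + v - 2 *\<^sub>R w)" using assms by (simp_all add: psd_op_def)
  moreover have "A v \<bullet> u = A u \<bullet> v" "A w \<bullet> u = A u \<bullet> w" "A w \<bullet> v = A v \<bullet> w"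
    using psd_op_inner_swap[OF assms] by (simp_all add: inner_commute)
  ultimately show ?thesis
    by (simp add: op_seminorm_square[OF assms] linear_diff linear_add linear_scale inner_diff_left
      inner_diff_right inner_add_left inner_add_right)
qed

lemma norm_diff_square_le:
  fixes u v w :: "'a::real_inner"
  shows "(norm (u - v))\<^sup>2 \<le> 2 * (norm (w - u))\<^sup>2 + 2 * (norm (w - v))\<^sup>2"
proof -
  have "0 \<le> (u + v - 2 *\<^sub>R w) \<bullet> (u + v - 2 *\<^sub>R w)" by simp
  then show ?thesis
    by (simp add: power2_norm_eq_inner inner_diff_left
      inner_diff_right inner_add_left inner_add_right inner_commute)
qed

lemma op_seminorm_y_weight_square:
  fixes G :: "'y::euclidean_space \<Rightarrow> 'y" and C :: "'y \<Rightarrow> 'x::euclidean_space"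
  assumes "psd_op G" "linear C" "\<beta> > 0"
  shows "(op_seminorm (y_weight G C \<beta>) v)\<^sup>2 = (op_seminorm G v)\<^sup>2 + \<beta> * (norm (C v))\<^sup>2"
  using adjoint_works[OF assms(2), of v "C v"]
  by (simp add: op_seminorm_square psd_op_y_weight assms)
    (simp add: y_weight_def inner_add_left power2_norm_eq_inner inner_commute[of "adjoint C _"])

text \<open>Cauchy-Schwarz reduces the claim to a real binary form in the two norms with nonpositive
  discriminant, which is bounded below by a square.\<close>

lemma quadratic_form_nonneg:
  fixes a b :: "'a::real_inner"
  assumes "0 \<le> \<alpha>" "0 \<le> \<gamma>" "\<kappa>\<^sup>2 \<le> \<alpha> * \<gamma>"
  shows "0 \<le> \<alpha> * (norm a)\<^sup>2 + 2 * \<kappa> * (a \<bullet> b) + \<gamma> * (norm b)\<^sup>2"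
proof -
  have "\<bar>\<kappa> * (a \<bullet> b)\<bar> \<le> (sqrt \<alpha> * sqrt \<gamma>) * (norm a * norm b)"
    unfolding abs_mult
    using real_le_rsqrt[of "\<bar>\<kappa>\<bar>" "\<alpha> * \<gamma>"] assms Cauchy_Schwarz_ineq2[of a b]
    by (intro mult_mono) (auto simp: real_sqrt_mult)
  moreover have "0 \<le> (sqrt \<alpha> * norm a - sqrt \<gamma> * norm b)\<^sup>2" by simp
  then have "2 * ((sqrt \<alpha> * sqrt \<gamma>) * (norm a * norm b)) \<le> \<alpha> * (norm a)\<^sup>2 + \<gamma> * (norm b)\<^sup>2"
    using assms by (simp add: power2_diff power_mult_distrib algebra_simps)
  ultimately show ?thesis by linarith
qed

section \<open>Properties of \<open>sigma_theta\<close>\<close>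

text \<open>The upper bound is the golden ratio, the positive root of
  \<open>t\<^sup>2 = t + 1\<close>; it enters through \<open>less_2\<close> and
  \<open>square_le\<close>.\<close>

locale golden_stepsize =
  fixes \<theta> :: real
  assumes pos: "0 < \<theta>" and le: "\<theta> \<le> (sqrt 5 + 1) / 2"
begin

lemma less_2: "\<theta> < 2"
proof -
  have "sqrt 5 < (3::real)" by (rule real_less_lsqrt) auto
  with le show ?thesis by simp
qed

lemma square_le: "\<theta>\<^sup>2 \<le> \<theta> + 1"
proof -
  have "\<bar>2 * \<theta> - 1\<bar> \<le> sqrt 5"
  proof (rule abs_leI)
    have "1 \<le> sqrt (5::real)" by simp
    then show "- (2 * \<theta> - 1) \<le> sqrt 5" using pos by linarith
  qed (use le in simp)
  then have "(2 * \<theta> - 1)\<^sup>2 \<le> 5"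
    by (rule sqrt_ge_absD)
  then show ?thesis by (simp add: power2_eq_square algebra_simps)
qed

text \<open>The number \<open>sigma_theta \<theta>\<close> is the larger root of \<open>Q\<close>. By \<open>Q_alt\<close>, \<open>Q\<close> is up to a
  positive factor the determinant of the quadratic form in
  $(\Delta x_{k-1}, C\Delta y_k)$ that bounds the gap in the error condition for $k \ge 2$.\<close>

definition Q :: "real \<Rightarrow> real" where
  "Q t = (3 - \<theta>) * t\<^sup>2 - (3 * \<theta>\<^sup>2 - 7 * \<theta> + 5) * t + (2 - \<theta>) * (\<theta> - 1)\<^sup>2"

lemma Q_alt: "\<theta> * Q t = (t - (\<theta> - 1)\<^sup>2) * (t * (\<theta> + 1) - 1) - (\<theta> - 1)\<^sup>2 * (t + \<theta> - 1)\<^sup>2"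
  by (simp add: Q_def power2_eq_square algebra_simps)

lemma Q_complete_square: "4 * (3 - \<theta>) * Q t = (2 * (3 - \<theta>) * t - (3 * \<theta>\<^sup>2 - 7 * \<theta> + 5))\<^sup>2
   - ((3 * \<theta>\<^sup>2 - 7 * \<theta> + 5)\<^sup>2 - 4 * (2 - \<theta>) * (3 - \<theta>) * (\<theta> - 1)\<^sup>2)"
  by (simp add: Q_def power2_eq_square algebra_simps)

lemma sigma_theta_eq: "2 * (3 - \<theta>) * sigma_theta \<theta> - (3 * \<theta>\<^sup>2 - 7 * \<theta> + 5) =
   sqrt ((3 * \<theta>\<^sup>2 - 7 * \<theta> + 5)\<^sup>2 - 4 * (2 - \<theta>) * (3 - \<theta>) * (\<theta> - 1)\<^sup>2)"
  using less_2 by (simp add: sigma_theta_def)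

text \<open>The leading coefficient of \<open>Q\<close> is positive, so a point where
  \<open>Q\<close> is nonpositive cannot exceed the larger root. Good test points are
  \<open>(\<theta> - 1)\<^sup>2\<close> and \<open>1 / (\<theta> + 1)\<close>: each annihilates the
  product in \<open>Q_alt\<close> and leaves minus a square.\<close>

lemma le_sigma_theta:
  assumes "Q t \<le> 0"
  shows "t \<le> sigma_theta \<theta>"
proof -
  have "(3 - \<theta>) * Q t \<le> 0"
    using assms less_2 by (simp add: mult_nonneg_nonpos)
  then have "2 * (3 - \<theta>) * t - (3 * \<theta>\<^sup>2 - 7 * \<theta> + 5) \<le> 2 * (3 - \<theta>) * sigma_theta \<theta> - (3 * \<theta>\<^sup>2 - 7 * \<theta> + 5)"
    unfolding sigma_theta_eq using Q_complete_square[of t] by (intro real_le_rsqrt) linarith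
  then show ?thesis using less_2 by simp
qed

lemma Q_le_0: "Q ((\<theta> - 1)\<^sup>2) \<le> 0"
proof -
  have "\<theta> * Q ((\<theta> - 1)\<^sup>2) \<le> 0" unfolding Q_alt by simp
  then show ?thesis using pos by (simp add: mult_le_0_iff)
qed

lemma sigma_theta_ge_square: "(\<theta> - 1)\<^sup>2 \<le> sigma_theta \<theta>"
  by (rule le_sigma_theta[OF Q_le_0])

lemma sigma_theta_nonneg: "0 \<le> sigma_theta \<theta>"
  using sigma_theta_ge_square zero_le_power2 order_trans by blast

lemma sigma_theta_ge_inverse: "1 \<le> sigma_theta \<theta> * (\<theta> + 1)"
proof -
  have "\<theta> * Q (1 / (\<theta> + 1)) \<le> 0" unfolding Q_alt using pos by simp
  then have "1 / (\<theta> + 1) \<le> sigma_theta \<theta>"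
    using pos by (intro le_sigma_theta) (simp add: mult_le_0_iff)
  then show ?thesis using pos by (simp add: field_simps)
qed

text \<open>A nonpositive value of \<open>Q\<close> forces its discriminant to be nonnegative, so
  squaring the square root in \<open>sigma_theta\<close> returns the discriminant.\<close>

lemma sigma_theta_root: "Q (sigma_theta \<theta>) = 0"
proof -
  have "(3 - \<theta>) * Q ((\<theta> - 1)\<^sup>2) \<le> 0"
    using less_2 Q_le_0 by (simp add: mult_nonneg_nonpos)
  with Q_complete_square[of "(\<theta> - 1)\<^sup>2"]
    zero_le_power2[of "2 * (3 - \<theta>) * (\<theta> - 1)\<^sup>2 - (3 * \<theta>\<^sup>2 - 7 * \<theta> + 5)"]
  have "0 \<le> (3 * \<theta>\<^sup>2 - 7 * \<theta> + 5)\<^sup>2 - 4 * (2 - \<theta>) * (3 - \<theta>) * (\<theta> - 1)\<^sup>2"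
    by linarith
  then have "4 * (3 - \<theta>) * Q (sigma_theta \<theta>) = 0"
    unfolding Q_complete_square sigma_theta_eq by simp
  then show ?thesis using less_2 by simp
qed

text \<open>The golden ratio bound gives \<open>0 \<le> Q 1\<close>, and 1 is not to the left of the
  vertex of \<open>Q\<close>; hence 1 is not below the larger root.\<close>

lemma sigma_theta_le_1: "sigma_theta \<theta> \<le> 1"
proof -
  have "Q 1 = \<theta> * (1 + \<theta> - \<theta>\<^sup>2)"
    by (simp add: Q_def power2_eq_square algebra_simps)
  then have "0 \<le> (3 - \<theta>) * Q 1" using pos less_2 square_le by simp
  moreover have "3 * \<theta>\<^sup>2 - 7 * \<theta> + 5 \<le> 2 * (3 - \<theta>)"
  proof -
    have "\<theta> * \<theta> \<le> \<theta> * 2" using less_2 pos by (intro mult_left_mono) auto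
    then show ?thesis using square_le unfolding power2_eq_square by argo
  qed
  ultimately have "2 * (3 - \<theta>) * sigma_theta \<theta> - (3 * \<theta>\<^sup>2 - 7 * \<theta> + 5) \<le> 2 * (3 - \<theta>) - (3 * \<theta>\<^sup>2 - 7 * \<theta> + 5)"
    unfolding sigma_theta_eq using Q_complete_square[of 1] unfolding mult_1_right
    by (intro real_le_lsqrt) linarith+
  then have "(2 * (3 - \<theta>)) * sigma_theta \<theta> \<le> (2 * (3 - \<theta>)) * 1"
    by simp
  then show ?thesis
    using less_2 by (subst (asm) mult_le_cancel_left_pos) simp_all
qed

text \<open>Since \<open>1 - \<theta>\<^sup>2 \<le> 1\<close>, the lower bound
  \<open>1 / (\<theta> + 1)\<close> of \<open>sigma_theta \<theta>\<close> is at least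
  \<open>1 - \<theta>\<close>.\<close>

lemma sigma_theta_add_ge: "0 \<le> sigma_theta \<theta> + \<theta> - 1"
proof -
  have "(1 - \<theta>) * (\<theta> + 1) \<le> 1" by (simp add: algebra_simps)
  then have "(1 - \<theta>) * (\<theta> + 1) \<le> sigma_theta \<theta> * (\<theta> + 1)"
    using sigma_theta_ge_inverse by linarith
  then show ?thesis using pos by (simp add: mult_le_cancel_right)
qed

text \<open>This is \<open>Q_alt\<close> at the root. It makes the quadratic form in
  \<open>error_condition_Suc\<close> degenerate and thus just nonnegative.\<close>

lemma sigma_theta_discriminant:
  "((sigma_theta \<theta> + \<theta> - 1) * (1 - \<theta>))\<^sup>2 = (sigma_theta \<theta> - (\<theta> - 1)\<^sup>2) * (sigma_theta \<theta> * (\<theta> + 1) - 1)"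
  using Q_alt[of "sigma_theta \<theta>"] by (simp add: sigma_theta_root power_mult_distrib power2_commute[of 1])

end

text \<open>All values of \<open>w\<close> cancel, and only the gradients at \<open>p\<close> and
  \<open>q\<close> remain.\<close>

lemma bregman_three_point:
  "(gradient w p - gradient w q) \<bullet> (u - v)
    = bregman w p v - bregman w q v - bregman w p u + bregman w q u"
  by (simp add: bregman_def inner_diff_left inner_diff_right)

section \<open>The ADMM iterates and the inclusion in \<open>T\<close>\<close>

locale proximal_admm_run = golden_stepsize \<theta> for \<theta> :: real +
  fixes f :: "'y::euclidean_space \<Rightarrow> ereal" and g :: "'s::euclidean_space \<Rightarrow> ereal"
    and C :: "'y \<Rightarrow> 'x::euclidean_space" and D :: "'s \<Rightarrow> 'x" and c :: 'x
    and H :: "'s \<Rightarrow> 's" and G :: "'y \<Rightarrow> 'y" and \<beta> :: real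
    and s :: "nat \<Rightarrow> 's" and y :: "nat \<Rightarrow> 'y" and x xt :: "nat \<Rightarrow> 'x"
  assumes f: "proper_fun f" "convex_fun f"
    and g: "proper_fun g" "convex_fun g"
    and C: "linear C" and D: "linear D"
    and H: "psd_op H" and G: "psd_op G"
    and \<beta>: "\<beta> > 0"
    and admm: "proximal_admm f g C D c H G \<beta> \<theta> (s 0) (y 0) (x 0) s y x"
    and xt: "xt (Suc k) = x k - \<beta> *\<^sub>R (C (y k) + D (s (Suc k)) - c)"
begin

abbreviation "T \<equiv> admm_T f g C D c"
abbreviation "w \<equiv> admm_w H G C \<beta> \<theta>"
abbreviation "\<sigma> \<equiv> sigma_theta \<theta>"

text \<open>Increments are indexed by their left end: \<open>dx k\<close> is $\Delta x_{k+1}$, and \<open>slack k\<close> is $\eta_{k+1}$.\<close>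

definition "z k = (s k, y k, x k)"
definition "zt k = (s k, y k, xt k)"
definition "dx k = x (Suc k) - x k"
definition "dy k = y (Suc k) - y k"
definition "ds k = s (Suc k) - s k"

definition "slack k = (\<sigma> - (\<theta> - 1)\<^sup>2) * ((norm (dx k))\<^sup>2 / (2 * \<beta> * \<theta> ^ 3))
  + (\<sigma> + \<theta> - 1) / (2 * \<theta>) * (op_seminorm G (dy k))\<^sup>2"

lemmas C_diff = linear_diff[OF C]

lemma y_weight: "psd_op (y_weight G C \<beta>)"
  using psd_op_y_weight[OF G C \<beta>] .

lemmas iteration = admm[unfolded proximal_admm_def, THEN conjunct2, THEN conjunct2, THEN conjunct2, THEN spec]

lemma x_Suc: "x (Suc k) = x k - (\<theta> * \<beta>) *\<^sub>R (C (y (Suc k)) + D (s (Suc k)) - c)"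
  using iteration[of "Suc k"] by simp

lemma feasibility_residual: "\<beta> *\<^sub>R (C (y (Suc k)) + D (s (Suc k)) - c) = - (1 / \<theta>) *\<^sub>R dx k"
  using pos by (simp add: dx_def x_Suc)

text \<open>The residual defining \<open>xt\<close> uses the old \<open>y\<close>; passing to the
  new one costs \<open>C (dy k)\<close>, and the new residual is a multiple of
  \<open>dx k\<close>.\<close>

lemma xt_minus_old: "xt (Suc k) - x k = (1 / \<theta>) *\<^sub>R dx k + \<beta> *\<^sub>R C (dy k)"
proof -
  have "xt (Suc k) - x k = \<beta> *\<^sub>R C (dy k) - \<beta> *\<^sub>R (C (y (Suc k)) + D (s (Suc k)) - c)"
    by (simp add: xt dy_def C_diff algebra_simps)
  then show ?thesis unfolding feasibility_residual by simp
qed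

lemma xt_minus_new: "xt (Suc k) - x (Suc k) = ((1 - \<theta>) / \<theta>) *\<^sub>R dx k + \<beta> *\<^sub>R C (dy k)"
proof -
  have "xt (Suc k) - x (Suc k) = xt (Suc k) - x k - dx k" by (simp add: dx_def)
  moreover have "(1 / \<theta>) *\<^sub>R dx k - dx k = ((1 - \<theta>) / \<theta>) *\<^sub>R dx k"
    using pos by (simp add: diff_divide_distrib scaleR_diff_left)
  ultimately show ?thesis unfolding xt_minus_old by (simp add: algebra_simps)
qed

text \<open>The definition of \<open>xt\<close> absorbs the gradient of the penalty term: both use
  the residual at the old \<open>y\<close> and the new \<open>s\<close>.\<close>

lemma s_subgradient:
  "H (s k - s (Suc k)) + adjoint D (xt (Suc k)) \<in> subdifferential g (s (Suc k))"
proof -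
  let ?r = "C (y k) - c"
  have "is_minimizer (\<lambda>u. g u + ereal (- (adjoint D (x k) \<bullet> u)
            + \<beta> / 2 * (norm (C (y k) + D u - c))\<^sup>2
            + 1/2 * (op_seminorm H (u - s k))\<^sup>2)) (s (Suc k))"
    using iteration[of "Suc k"] by simp
  moreover have "C (y k) + D u - c = D u + ?r" for u by simp
  ultimately have "adjoint D (x k) - \<beta> *\<^sub>R adjoint D (D (s (Suc k)) + ?r) - H (s (Suc k) - s k)
      \<in> subdifferential g (s (Suc k))"
    using proximal_minimizer_subdifferential[OF g D H] by simp
  moreover have "adjoint D (xt (Suc k)) = adjoint D (x k) - \<beta> *\<^sub>R adjoint D (D (s (Suc k)) + ?r)"
    using adjoint_linear[OF D]
    by (simp add: xt linear_diff linear_scale add_diff_eq add.commute)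
  moreover have "H (s k - s (Suc k)) = - H (s (Suc k) - s k)"
    using H by (simp add: psd_op_def linear_diff)
  ultimately show ?thesis by simp
qed

lemma y_subgradient:
  "adjoint C (x k + (1 / \<theta>) *\<^sub>R dx k) - G (dy k) \<in> subdifferential f (y (Suc k))"
proof -
  let ?r = "D (s (Suc k)) - c"
  have "is_minimizer (\<lambda>v. f v + ereal (- (adjoint C (x k) \<bullet> v)
            + \<beta> / 2 * (norm (C v + D (s (Suc k)) - c))\<^sup>2
            + 1/2 * (op_seminorm G (v - y k))\<^sup>2)) (y (Suc k))"
    using iteration[of "Suc k"] by simp
  moreover have "C v + D (s (Suc k)) - c = C v + ?r" for v by simp
  ultimately have "adjoint C (x k) - \<beta> *\<^sub>R adjoint C (C (y (Suc k)) + ?r) - G (y (Suc k) - y k)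
      \<in> subdifferential f (y (Suc k))"
    using proximal_minimizer_subdifferential[OF f C G] by simp
  moreover have "adjoint C (x k) - \<beta> *\<^sub>R adjoint C (C (y (Suc k)) + ?r)
      = adjoint C (x k - \<beta> *\<^sub>R (C (y (Suc k)) + D (s (Suc k)) - c))"
    using adjoint_linear[OF C] by (simp add: linear_diff linear_scale add_diff_eq)
  ultimately show ?thesis unfolding feasibility_residual dy_def by simp
qed

text \<open>The multiplier in \<open>y_subgradient\<close> falls short of \<open>xt\<close> by
  \<open>\<beta> *\<^sub>R C (dy k)\<close>. Moving this term to the other side turns
  \<open>G\<close> into \<open>y_weight G C \<beta>\<close>, which explains the weight on
  \<open>y\<close> in the Bregman distance.\<close>

lemma residual: "gradient (bregman w (z (Suc k))) (z k) \<in> T (zt (Suc k))"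
proof -
  have x: "x k + (1 / \<theta>) *\<^sub>R dx k = xt (Suc k) - \<beta> *\<^sub>R C (dy k)"
    using xt_minus_old[of k] by (simp add: algebra_simps)
  have "adjoint C (xt (Suc k) - \<beta> *\<^sub>R C (dy k)) - G (dy k)
      = y_weight G C \<beta> (y k - y (Suc k)) + adjoint C (xt (Suc k))"
    using adjoint_linear[OF C] G
    by (simp add: y_weight_def dy_def psd_op_def C_diff linear_diff linear_add linear_scale algebra_simps)
  then have "y_weight G C \<beta> (y k - y (Suc k)) + adjoint C (xt (Suc k)) \<in> subdifferential f (y (Suc k))"
    using y_subgradient[of k] by (simp add: x)
  moreover have "(1 / (\<beta> * \<theta>)) *\<^sub>R (x k - x (Suc k)) = C (y (Suc k)) + D (s (Suc k)) - c"
    using pos \<beta> by (simp add: x_Suc mult.commute)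
  ultimately show ?thesis
    using s_subgradient[of k]
    by (simp add: z_def zt_def admm_T_def gradient_bregman_admm_w[OF H G C \<beta>] image_iff eq_diff_eq)
qed

lemma residual_enlargement:
  "gradient (bregman w (z (Suc k))) (z k) \<in> enlargement T 0 (zt (Suc k))"
  unfolding enlargement_def
  using admm_T_monotone[OF f(1) g(1) C D residual] by auto

section \<open>Closed forms for the error condition\<close>

lemma slack_nonneg: "0 \<le> slack k"
  using sigma_theta_ge_square sigma_theta_add_ge pos \<beta> by (simp add: slack_def)

lemma bregman_old: "bregman w (z k) (zt (Suc k)) = 1/2 * (op_seminorm H (ds k))\<^sup>2
   + 1/2 * ((op_seminorm G (dy k))\<^sup>2 + \<beta> * (norm (C (dy k)))\<^sup>2)
   + 1 / (2 * \<beta> * \<theta>) * ((norm (dx k))\<^sup>2 / \<theta>\<^sup>2 + 2 * \<beta> / \<theta> * (dx k \<bullet> C (dy k)) + \<beta>\<^sup>2 * (norm (C (dy k)))\<^sup>2)"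
proof -
  have "(norm (xt (Suc k) - x k))\<^sup>2
      = (norm (dx k))\<^sup>2 / \<theta>\<^sup>2 + 2 * \<beta> / \<theta> * (dx k \<bullet> C (dy k)) + \<beta>\<^sup>2 * (norm (C (dy k)))\<^sup>2"
    unfolding xt_minus_old power2_norm_eq_inner
    by (simp add: inner_add_left inner_add_right inner_commute power2_eq_square)
  then show ?thesis
    by (simp add: z_def zt_def bregman_admm_w[OF H G C \<beta>] op_seminorm_y_weight_square[OF G C \<beta>]
        ds_def dy_def)
qed

text \<open>\<open>zt (Suc k)\<close> and \<open>z (Suc k)\<close> share their first two components,
  so only the multiplier part survives.\<close>

lemma bregman_new: "bregman w (z (Suc k)) (zt (Suc k)) =
   1 / (2 * \<beta> * \<theta>) * (((1 - \<theta>) / \<theta>)\<^sup>2 * (norm (dx k))\<^sup>2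
     + 2 * \<beta> * ((1 - \<theta>) / \<theta>) * (dx k \<bullet> C (dy k)) + \<beta>\<^sup>2 * (norm (C (dy k)))\<^sup>2)"
proof -
  have "(norm (xt (Suc k) - x (Suc k)))\<^sup>2
      = ((1 - \<theta>) / \<theta>)\<^sup>2 * (norm (dx k))\<^sup>2
     + 2 * \<beta> * ((1 - \<theta>) / \<theta>) * (dx k \<bullet> C (dy k)) + \<beta>\<^sup>2 * (norm (C (dy k)))\<^sup>2"
    unfolding xt_minus_new power2_norm_eq_inner
    by (simp add: inner_add_left inner_add_right inner_commute power2_eq_square)
  then show ?thesis
    using H y_weight
    by (simp add: z_def zt_def bregman_admm_w[OF H G C \<beta>] op_seminorm_def)
qed

text \<open>The coefficient of \<open>(norm (dx k))\<^sup>2\<close> in \<open>slack\<close> is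
  chosen so that this square cancels. The possibly negative terms are the cross term and, for
  \<open>\<theta> > 1\<close>, the \<open>G\<close> term.\<close>

lemma gap_eq:
  "\<sigma> * bregman w (z k) (zt (Suc k)) - bregman w (z (Suc k)) (zt (Suc k)) - slack k
   = (\<sigma> + \<theta> - 1) / \<theta>\<^sup>2 * (dx k \<bullet> C (dy k)) + \<beta> * (\<sigma> * (\<theta> + 1) - 1) / (2 * \<theta>) * (norm (C (dy k)))\<^sup>2
     + (1 - \<sigma>) * (1 - \<theta>) / (2 * \<theta>) * (op_seminorm G (dy k))\<^sup>2 + \<sigma> / 2 * (op_seminorm H (ds k))\<^sup>2"
proof -
  have "\<sigma> * (1/2 * F + 1/2 * (E + \<beta> * M) + 1 / (2 * \<beta> * \<theta>) * (N / \<theta>\<^sup>2 + 2 * \<beta> / \<theta> * m + \<beta>\<^sup>2 * M))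
      - 1 / (2 * \<beta> * \<theta>) * (((1 - \<theta>) / \<theta>)\<^sup>2 * N + 2 * \<beta> * ((1 - \<theta>) / \<theta>) * m + \<beta>\<^sup>2 * M)
      - ((\<sigma> - (\<theta> - 1)\<^sup>2) * (N / (2 * \<beta> * \<theta> ^ 3)) + (\<sigma> + \<theta> - 1) / (2 * \<theta>) * E)
    = (\<sigma> + \<theta> - 1) / \<theta>\<^sup>2 * m + \<beta> * (\<sigma> * (\<theta> + 1) - 1) / (2 * \<theta>) * M
      + (1 - \<sigma>) * (1 - \<theta>) / (2 * \<theta>) * E + \<sigma> / 2 * F" for E F M N m :: real
    using pos \<beta> by (simp add: divide_simps power2_eq_square power3_eq_cube) algebra
  then show ?thesis
    unfolding bregman_old bregman_new slack_def .
qed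

section \<open>The error condition after the first iteration\<close>

text \<open>Monotonicity of the subdifferential of \<open>f\<close> at consecutive iterates,
  multiplied by \<open>\<theta>\<close>. The mixed \<open>G\<close> product is split by
  \<open>psd_op_inner_bound\<close>, which produces the difference of squares.\<close>

lemma consecutive_y_subgradients:
  "\<theta> / 2 * ((op_seminorm G (dy (Suc k)))\<^sup>2 - (op_seminorm G (dy k))\<^sup>2)
    \<le> dx (Suc k) \<bullet> C (dy (Suc k)) - (1 - \<theta>) * (dx k \<bullet> C (dy (Suc k)))"
proof -
  let ?a = "(x (Suc k) + (1 / \<theta>) *\<^sub>R dx (Suc k)) - (x k + (1 / \<theta>) *\<^sub>R dx k)"
  have a: "\<theta> *\<^sub>R ?a = dx (Suc k) - (1 - \<theta>) *\<^sub>R dx k"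
    using pos by (simp add: dx_def algebra_simps)
  have "adjoint C ?a \<bullet> dy (Suc k) = ?a \<bullet> C (dy (Suc k))"
    using adjoint_works[OF C] by (simp add: inner_commute)
  then have "0 \<le> ?a \<bullet> C (dy (Suc k)) - G (dy (Suc k)) \<bullet> dy (Suc k) + G (dy k) \<bullet> dy (Suc k)"
    using subdifferential_monotone[OF f(1) y_subgradient[of "Suc k"] y_subgradient[of k]]
      linear_diff[OF adjoint_linear[OF C]]
    by (simp add: dy_def[of "Suc k", symmetric] inner_diff_left)
  moreover have "2 * (G (dy k) \<bullet> dy (Suc k)) \<le> (op_seminorm G (dy k))\<^sup>2 + (op_seminorm G (dy (Suc k)))\<^sup>2"
    by (rule psd_op_inner_bound[OF G])
  ultimately have "1/2 * ((op_seminorm G (dy (Suc k)))\<^sup>2 - (op_seminorm G (dy k))\<^sup>2) \<le> ?a \<bullet> C (dy (Suc k))"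
    unfolding op_seminorm_square[OF G, symmetric] by argo
  then have "\<theta> * (1/2 * ((op_seminorm G (dy (Suc k)))\<^sup>2 - (op_seminorm G (dy k))\<^sup>2)) \<le> \<theta> * (?a \<bullet> C (dy (Suc k)))"
    using pos by (intro mult_left_mono) auto
  also have "\<dots> = (\<theta> *\<^sub>R ?a) \<bullet> C (dy (Suc k))" by (rule inner_scaleR_left[symmetric])
  finally show ?thesis unfolding a by (simp add: inner_diff_left)
qed

lemma error_condition_Suc:
  "bregman w (z (Suc (Suc k))) (zt (Suc (Suc k))) + slack (Suc k)
    \<le> \<sigma> * bregman w (z (Suc k)) (zt (Suc (Suc k))) + slack k"
proof -
  let ?a = "dx k" and ?b = "C (dy (Suc k))"
  \<comment> \<open>\<open>\<alpha>\<close> is the weight of \<open>(norm (dx k))\<^sup>2\<close> in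
    \<open>slack k\<close>, \<open>\<gamma>\<close> the weight of the \<open>C\<close> term in
    \<open>gap_eq\<close>, and \<open>2 * \<kappa>\<close> the weight of the cross term once
    \<open>dx (Suc k)\<close> is traded for \<open>dx k\<close>.\<close>
  define \<alpha> where "\<alpha> = (\<sigma> - (\<theta> - 1)\<^sup>2) / (2 * \<beta> * \<theta> ^ 3)"
  define \<gamma> where "\<gamma> = \<beta> * (\<sigma> * (\<theta> + 1) - 1) / (2 * \<theta>)"
  define \<kappa> where "\<kappa> = (\<sigma> + \<theta> - 1) * (1 - \<theta>) / (2 * \<theta>\<^sup>2)"
  have "\<kappa>\<^sup>2 = \<alpha> * \<gamma>"
    unfolding \<kappa>_def power_divide sigma_theta_discriminant \<alpha>_def \<gamma>_def
    using pos \<beta> by (simp add: divide_simps) (simp add: power2_eq_square power3_eq_cube power4_eq_xxxx)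
  then have form: "0 \<le> \<alpha> * (norm ?a)\<^sup>2 + 2 * \<kappa> * (?a \<bullet> ?b) + \<gamma> * (norm ?b)\<^sup>2"
    using sigma_theta_ge_square sigma_theta_ge_inverse pos \<beta>
    by (intro quadratic_form_nonneg) (auto simp: \<alpha>_def \<gamma>_def)
  have "(\<sigma> + \<theta> - 1) / \<theta>\<^sup>2 * (\<theta> / 2 * ((op_seminorm G (dy (Suc k)))\<^sup>2 - (op_seminorm G (dy k))\<^sup>2))
      \<le> (\<sigma> + \<theta> - 1) / \<theta>\<^sup>2 * (dx (Suc k) \<bullet> ?b - (1 - \<theta>) * (?a \<bullet> ?b))"
    using sigma_theta_add_ge by (intro mult_left_mono consecutive_y_subgradients) simp
  also have "\<dots> = (\<sigma> + \<theta> - 1) / \<theta>\<^sup>2 * (dx (Suc k) \<bullet> ?b) - 2 * \<kappa> * (?a \<bullet> ?b)"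
    by (simp add: \<kappa>_def right_diff_distrib[of _ "dx (Suc k) \<bullet> _"])
  \<comment> \<open>The middle term cancels the \<open>G\<close> term of \<open>gap_eq\<close> and
    the last one that of \<open>slack k\<close>; the surplus is the nonnegative first term.\<close>
  also have "(\<sigma> + \<theta> - 1) / \<theta>\<^sup>2 * (\<theta> / 2 * ((op_seminorm G (dy (Suc k)))\<^sup>2 - (op_seminorm G (dy k))\<^sup>2))
     = \<sigma> / 2 * (op_seminorm G (dy (Suc k)))\<^sup>2 - (1 - \<sigma>) * (1 - \<theta>) / (2 * \<theta>) * (op_seminorm G (dy (Suc k)))\<^sup>2
       - (\<sigma> + \<theta> - 1) / (2 * \<theta>) * (op_seminorm G (dy k))\<^sup>2"
    using pos by (simp add: divide_simps power2_eq_square) (simp add: algebra_simps)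
  moreover have "slack k = \<alpha> * (norm ?a)\<^sup>2 + (\<sigma> + \<theta> - 1) / (2 * \<theta>) * (op_seminorm G (dy k))\<^sup>2"
    by (simp add: slack_def \<alpha>_def)
  moreover have "0 \<le> \<sigma> / 2 * (op_seminorm G (dy (Suc k)))\<^sup>2" "0 \<le> \<sigma> / 2 * (op_seminorm H (ds (Suc k)))\<^sup>2"
    using sigma_theta_nonneg by simp_all
  ultimately show ?thesis
    using gap_eq[of "Suc k", folded \<gamma>_def] form by linarith
qed

section \<open>The error condition at the first iteration\<close>

text \<open>Monotonicity of \<open>T\<close> between \<open>zt (Suc k)\<close> and the zero
  \<open>z'\<close>, rewritten by the three-point identity.\<close>

lemma fejer:
  assumes "z' \<in> zeros T"
  shows "bregman w (z (Suc k)) z' + bregman w (z k) (zt (Suc k)) - bregman w (z (Suc k)) (zt (Suc k))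
    \<le> bregman w (z k) z'"
proof -
  have "gradient (bregman w (z (Suc k))) (z k) = gradient w (z k) - gradient w (z (Suc k))"
    using gradient_eqI[OF admm_w_gderiv[OF H G C \<beta>], of \<theta>] H y_weight
    by (simp add: z_def gradient_bregman_admm_w[OF H G C \<beta>] psd_op_def linear_diff scaleR_diff_right)
  moreover have "0 \<le> (gradient (bregman w (z (Suc k))) (z k) - 0) \<bullet> (zt (Suc k) - z')"
    using assms by (intro admm_T_monotone[OF f(1) g(1) C D residual]) (simp add: zeros_def)
  ultimately show ?thesis
    using bregman_three_point[of w "z k" "z (Suc k)" "zt (Suc k)" z'] by simp
qed

text \<open>Each increment is routed through \<open>z'\<close>, at the price of a factor 2; the
  nonnegative \<open>H\<close> parts of the distances are dropped.\<close>

lemma increments_le_bregman: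
  "(norm (dx k))\<^sup>2 / (2 * \<beta> * \<theta>) + \<beta> / 2 * (norm (C (dy k)))\<^sup>2 + 1/2 * (op_seminorm G (dy k))\<^sup>2
    \<le> 2 * (bregman w (z k) z' + bregman w (z (Suc k)) z')"
proof -
  obtain s' y' x' where z': "z' = (s', y', x')" by (metis prod.exhaust)
  have breg: "bregman w (z j) z' = 1/2 * (op_seminorm H (s' - s j))\<^sup>2
      + 1/2 * (op_seminorm (y_weight G C \<beta>) (y' - y j))\<^sup>2 + (norm (x' - x j))\<^sup>2 / (2 * \<beta> * \<theta>)" for j
    by (simp add: z_def z' bregman_admm_w[OF H G C \<beta>])
  have "(norm (dx k))\<^sup>2 / (2 * \<beta> * \<theta>)
      \<le> (2 * (norm (x' - x (Suc k)))\<^sup>2 + 2 * (norm (x' - x k))\<^sup>2) / (2 * \<beta> * \<theta>)"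
    unfolding dx_def using pos \<beta> by (intro divide_right_mono norm_diff_square_le) auto
  also have "\<dots> = 2 * ((norm (x' - x (Suc k)))\<^sup>2 / (2 * \<beta> * \<theta>)) + 2 * ((norm (x' - x k))\<^sup>2 / (2 * \<beta> * \<theta>))"
    by (simp add: add_divide_distrib)
  moreover have "(op_seminorm G (dy k))\<^sup>2 + \<beta> * (norm (C (dy k)))\<^sup>2 \<le>
      2 * (op_seminorm (y_weight G C \<beta>) (y' - y (Suc k)))\<^sup>2 + 2 * (op_seminorm (y_weight G C \<beta>) (y' - y k))\<^sup>2"
    unfolding dy_def op_seminorm_y_weight_square[OF G C \<beta>, symmetric]
    by (rule op_seminorm_diff_square_le[OF y_weight])
  moreover have "0 \<le> (op_seminorm H (s' - s k))\<^sup>2" "0 \<le> (op_seminorm H (s' - s (Suc k)))\<^sup>2"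
    by simp_all
  ultimately show ?thesis
    unfolding breg by argo
qed

lemma bregman_nonneg: "0 \<le> bregman w (z k) z'"
  using pos \<beta> by (cases z' rule: prod_cases3) (simp add: z_def bregman_admm_w[OF H G C \<beta>])

text \<open>The two factors match the two estimates of \<open>error_condition_first\<close>:
  \<open>1 / sqrt \<theta>\<close> bounds the negative terms of the gap, and the maximum bounds
  \<open>d + d'\<close> by \<open>d\<close>.\<close>

lemma tau_theta_eq: "tau_theta \<theta> = 4 / sqrt \<theta> * max 1 (\<theta> / (2 - \<theta>))"
proof -
  have "4 / sqrt \<theta> * max 1 (\<theta> / (2 - \<theta>)) = 4 * max (1 / sqrt \<theta> * 1) (1 / sqrt \<theta> * (\<theta> / (2 - \<theta>)))"
    using pos by (simp add: max_mult_distrib_left)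
  also have "1 / sqrt \<theta> * (\<theta> / (2 - \<theta>)) = (\<theta> / sqrt \<theta>) / (2 - \<theta>)"
    by simp
  also have "\<theta> / sqrt \<theta> = sqrt \<theta>"
    using pos by (intro real_div_sqrt) simp
  finally show ?thesis by (simp add: tau_theta_def)
qed

text \<open>With no earlier increment to compare with, the distance to a zero replaces the previous
  slack. The negative terms of \<open>gap_eq\<close> are at least
  \<open>-(A + B + E) / sqrt \<theta>\<close>, and \<open>A + B + E\<close> is controlled by
  \<open>d + d'\<close>.\<close>

lemma error_condition_first:
  assumes "z' \<in> zeros T"
  shows "bregman w (z (Suc k)) (zt (Suc k)) + slack k
    \<le> \<sigma> * bregman w (z k) (zt (Suc k)) + tau_theta \<theta> * bregman w (z k) z'"
proof -
  define d d' where "d = bregman w (z k) z'" and "d' = bregman w (z (Suc k)) z'"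
  define A where "A = (norm (dx k))\<^sup>2 / (2 * \<beta> * \<theta>)"
  define B where "B = \<beta> / 2 * (norm (C (dy k)))\<^sup>2"
  define E where "E = 1/2 * (op_seminorm G (dy k))\<^sup>2"
  define m where "m = dx k \<bullet> C (dy k)"
  have nn: "0 \<le> A" "0 \<le> B" "0 \<le> E" "0 \<le> d" "0 \<le> d'"
    using pos \<beta> bregman_nonneg by (simp_all add: A_def B_def E_def d_def d'_def)
  have ABE: "A + B + E \<le> 2 * (d + d')"
    using increments_le_bregman[of k z'] by (simp add: A_def B_def E_def d_def d'_def)
  \<comment> \<open>The weights spend exactly \<open>B\<close> and \<open>A / \<theta>\<close>, both
    present in the Bregman difference below, so only \<open>(\<theta> - 1) / \<theta> * A\<close> is
    left to correct \<open>d'\<close>.\<close>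
  have "0 \<le> 1 / (2 * \<beta> * \<theta>\<^sup>2) * (norm (dx k))\<^sup>2 + 2 * (1 / (2 * \<theta>)) * m + \<beta> / 2 * (norm (C (dy k)))\<^sup>2"
    unfolding m_def using pos \<beta>
    by (intro quadratic_form_nonneg) (simp_all add: power_divide power_mult_distrib)
  then have m1: "0 \<le> A / \<theta> + m / \<theta> + B"
    by (simp add: A_def B_def power2_eq_square mult.assoc)
  \<comment> \<open>Here the weights are balanced so that \<open>A\<close> and \<open>B\<close>
    receive the same factor, as \<open>ABE\<close> requires.\<close>
  have "0 \<le> (sqrt \<theta> / (2 * \<beta> * \<theta>)) * (norm (dx k))\<^sup>2 + 2 * (1 / 2) * m + (sqrt \<theta> * \<beta> / 2) * (norm (C (dy k)))\<^sup>2"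
    unfolding m_def using pos \<beta>
    by (intro quadratic_form_nonneg) (simp_all add: power_divide)
  then have m2: "- m \<le> sqrt \<theta> * (A + B)"
    by (simp add: A_def B_def distrib_left)
  have "bregman w (z k) (zt (Suc k)) - bregman w (z (Suc k)) (zt (Suc k))
      = 1/2 * (op_seminorm H (ds k))\<^sup>2 + E + B + (2 - \<theta>) / \<theta> * A + m / \<theta>"
    unfolding bregman_old bregman_new A_def B_def E_def m_def
    using pos \<beta> by (simp add: divide_simps power2_eq_square) (simp add: algebra_simps)
  moreover have "(2 - \<theta>) / \<theta> * A = A / \<theta> - (\<theta> - 1) / \<theta> * A"
    using pos by (simp add: field_simps)
  moreover have "0 \<le> 1/2 * (op_seminorm H (ds k))\<^sup>2" by simp
  ultimately have d': "d' \<le> d + (\<theta> - 1) / \<theta> * A"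
    using fejer[OF assms, of k] m1 nn unfolding d_def d'_def by linarith
  \<comment> \<open>For $\theta > 1$ the correction to \<open>d'\<close> is absorbed by bounding \<open>A\<close> through \<open>ABE\<close>; this is
    where the factor $\theta/(2-\theta)$ in $\tau_\theta$ comes from.\<close>
  have sum: "d + d' \<le> 2 * (max 1 (\<theta> / (2 - \<theta>)) * d)"
  proof (cases "\<theta> \<le> 1")
    case True
    then have "(\<theta> - 1) / \<theta> * A \<le> 0"
      using pos nn by (intro mult_nonpos_nonneg) (auto simp: divide_nonpos_pos)
    moreover have "1 * d \<le> max 1 (\<theta> / (2 - \<theta>)) * d"
      using nn by (intro mult_right_mono) auto
    ultimately show ?thesis using d' by linarith
  next
    case False
    have "(\<theta> - 1) / \<theta> * A \<le> (\<theta> - 1) / \<theta> * (2 * (d + d'))"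
      using False ABE nn by (intro mult_left_mono) auto
    with d' have "d' \<le> d + (\<theta> - 1) / \<theta> * (2 * (d + d'))" by linarith
    then have "(2 - \<theta>) * (d + d') \<le> 2 * (\<theta> * d)"
      using pos by (simp add: field_simps)
    then have "d + d' \<le> 2 * (\<theta> / (2 - \<theta>) * d)"
      using less_2 by (simp add: field_simps)
    also have "\<dots> \<le> 2 * (max 1 (\<theta> / (2 - \<theta>)) * d)"
      using nn by (intro mult_left_mono mult_right_mono) auto
    finally show ?thesis .
  qed
  have ts: "sqrt \<theta> * (1 / \<theta>) = 1 / sqrt \<theta>"
    using pos by (simp add: field_simps)
  have c1: "(\<sigma> + \<theta> - 1) / \<theta> \<le> 1"
    using sigma_theta_le_1 pos by simp
  have "(\<sigma> + \<theta> - 1) / \<theta>\<^sup>2 * (- m) \<le> (\<sigma> + \<theta> - 1) / \<theta>\<^sup>2 * (sqrt \<theta> * (A + B))"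
    using m2 sigma_theta_add_ge by (intro mult_left_mono) auto
  also have "\<dots> = (\<sigma> + \<theta> - 1) / \<theta> * ((sqrt \<theta> * (1 / \<theta>)) * (A + B))"
    by (simp add: power2_eq_square)
  also have "\<dots> \<le> 1 * (1 / sqrt \<theta> * (A + B))"
    unfolding ts using c1 nn pos by (intro mult_right_mono) auto
  finally have M: "(\<sigma> + \<theta> - 1) / \<theta>\<^sup>2 * (- m) \<le> 1 / sqrt \<theta> * (A + B)"
    by simp
  \<comment> \<open>Gives the \<open>G\<close> term the constant already found for the cross term,
    so that both combine into \<open>A + B + E\<close>.\<close>
  have "(1 - \<sigma>) * (\<theta> - 1) / \<theta> \<le> 1 / sqrt \<theta>"
  proof -
    have "(1 - \<sigma>) * (\<theta> - 1) \<le> sqrt \<theta>"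
    proof (cases "\<theta> \<le> 1")
      case True
      then have "(1 - \<sigma>) * (\<theta> - 1) \<le> 0" using sigma_theta_le_1 by (intro mult_nonneg_nonpos) auto
      then show ?thesis using pos real_sqrt_ge_zero[of \<theta>] by linarith
    next
      case False
      then have "(1 - \<sigma>) * (\<theta> - 1) \<le> 1 * 1"
        using sigma_theta_nonneg less_2 by (intro mult_mono) auto
      moreover have "1 \<le> sqrt \<theta>" using False by simp
      ultimately show ?thesis by linarith
    qed
    then have "(1 - \<sigma>) * (\<theta> - 1) / \<theta> \<le> sqrt \<theta> / \<theta>"
      using pos by (intro divide_right_mono) auto
    then show ?thesis using ts by simp
  qed
  then have "(1 - \<sigma>) * (\<theta> - 1) / \<theta> * E \<le> 1 / sqrt \<theta> * E"
    using nn by (intro mult_right_mono)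
  moreover have "1 / sqrt \<theta> * (A + B + E) \<le> 1 / sqrt \<theta> * (4 * (max 1 (\<theta> / (2 - \<theta>)) * d))"
    using ABE sum pos by (intro mult_left_mono) auto
  moreover have "1 / sqrt \<theta> * (4 * (max 1 (\<theta> / (2 - \<theta>)) * d)) = tau_theta \<theta> * d"
    unfolding tau_theta_eq by simp
  moreover have "(1 - \<sigma>) * (1 - \<theta>) = - ((1 - \<sigma>) * (\<theta> - 1))"
    by (simp add: algebra_simps)
  then have "(1 - \<sigma>) * (1 - \<theta>) / (2 * \<theta>) * (op_seminorm G (dy k))\<^sup>2 = - ((1 - \<sigma>) * (\<theta> - 1) / \<theta> * E)"
    by (simp add: E_def)
  moreover have "0 \<le> \<beta> * (\<sigma> * (\<theta> + 1) - 1) / (2 * \<theta>) * (norm (C (dy k)))\<^sup>2"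
    using sigma_theta_ge_inverse pos \<beta> by simp
  moreover have "0 \<le> \<sigma> / 2 * (op_seminorm H (ds k))\<^sup>2" using sigma_theta_nonneg by simp
  ultimately show ?thesis
    using gap_eq[of k] M unfolding m_def[symmetric] d_def[symmetric] distrib_left mult_minus_right
    by linarith
qed

lemma admm_d0_eq:
  "admm_d0 f g C D c H G \<beta> \<theta> (s 0) (y 0) (x 0) = (INF z'\<in>zeros T. bregman w (z 0) z')"
proof -
  have minus: "(op_seminorm A (u - v))\<^sup>2 = (op_seminorm A (v - u))\<^sup>2" if "psd_op A" for A :: "'a::real_inner \<Rightarrow> 'a" and u v
    using that linear_neg[of A "u - v"]
    by (metis inner_minus_left inner_minus_right minus_diff_eq op_seminorm_square psd_op_def)
  show ?thesis
    unfolding admm_d0_def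
    by (intro INF_cong refl)
      (auto simp: z_def bregman_admm_w[OF H G C \<beta>] minus[OF H, of "s 0"] minus[OF y_weight, of "y 0"]
        norm_minus_commute[of "x 0"])
qed

text \<open>The infimum is taken in the reals, so passing to it relies on \<open>zeros T\<close>
  being nonempty.\<close>

lemma admm_d0_greatest:
  assumes "zeros T \<noteq> {}" and "\<And>z'. z' \<in> zeros T \<Longrightarrow> r \<le> bregman w (z 0) z'"
  shows "r \<le> admm_d0 f g C D c H G \<beta> \<theta> (s 0) (y 0) (x 0)"
  unfolding admm_d0_eq using assms by (intro cINF_greatest)

end

section \<open>Assembling the NE-HPE conditions\<close>

theorem theorem4p4:
  fixes f :: "'y::euclidean_space \<Rightarrow> ereal" and g :: "'s::euclidean_space \<Rightarrow> ereal"
    and C :: "'y \<Rightarrow> 'x::euclidean_space" and D :: "'s \<Rightarrow> 'x" and c :: 'x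
    and H :: "'s \<Rightarrow> 's" and G :: "'y \<Rightarrow> 'y" and \<beta> \<theta> :: real
    and s\<^sub>0 :: 's and y\<^sub>0 :: 'y and x\<^sub>0 :: 'x
    and s :: "nat \<Rightarrow> 's" and y :: "nat \<Rightarrow> 'y" and x xt :: "nat \<Rightarrow> 'x"
    and \<eta> :: "nat \<Rightarrow> real"
  assumes f: "proper_fun f" "closed_fun f" "convex_fun f"
    and g: "proper_fun g" "closed_fun g" "convex_fun g"
    and C: "linear C" and D: "linear D"
    and A1: "zeros (admm_T f g C D c) \<noteq> {}"
    and A2: "\<exists>u. adjoint C u \<in> rel_interior (edomain (conjugate f)) \<and>
                 adjoint D u \<in> rel_interior (edomain (conjugate g))"
    and H: "psd_op H" and G: "psd_op G"
    and \<beta>: "\<beta> > 0"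
    and \<theta>: "0 < \<theta>" "\<theta> \<le> (sqrt 5 + 1) / 2"
    and admm: "proximal_admm f g C D c H G \<beta> \<theta> s\<^sub>0 y\<^sub>0 x\<^sub>0 s y x"
    and xt: "\<forall>k\<ge>1. xt k = x (k - 1) - \<beta> *\<^sub>R (C (y (k - 1)) + D (s k) - c)"
    and eta_0: "\<eta> 0 = tau_theta \<theta> * admm_d0 f g C D c H G \<beta> \<theta> s\<^sub>0 y\<^sub>0 x\<^sub>0"
    and eta: "\<forall>k\<ge>1. \<eta> k =
       (sigma_theta \<theta> - (\<theta> - 1)\<^sup>2) * ((norm (x k - x (k - 1)))\<^sup>2 / (2 * \<beta> * \<theta> ^ 3))
       + (sigma_theta \<theta> + \<theta> - 1) / (2 * \<theta>) * (op_seminorm G (y k - y (k - 1)))\<^sup>2"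
  shows "NE_HPE_instance (admm_T f g C D c) (admm_w H G C \<beta> \<theta>) (s\<^sub>0, y\<^sub>0, x\<^sub>0) (\<eta> 0) (sigma_theta \<theta>)
           (\<lambda>k. (s k, y k, x k)) (\<lambda>k. (s k, y k, xt k)) (\<lambda>k. 1) (\<lambda>k. 0) \<eta>"
proof -
  have init: "s 0 = s\<^sub>0" "y 0 = y\<^sub>0" "x 0 = x\<^sub>0"
    using admm unfolding proximal_admm_def by blast+
  interpret proximal_admm_run \<theta> f g C D c H G \<beta> s y x xt
  proof unfold_locales
    show "proximal_admm f g C D c H G \<beta> \<theta> (s 0) (y 0) (x 0) s y x"
      unfolding init by (fact admm)
    show "xt (Suc k) = x k - \<beta> *\<^sub>R (C (y k) + D (s (Suc k)) - c)" for k
      using xt by simp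
  qed (fact assms linear_add[OF C] linear_scale[OF C] linear_add[OF D] linear_scale[OF D])+
  have slack: "\<eta> (Suc k) = slack k" for k
    using eta by (simp add: slack_def dx_def dy_def)
  have tau: "0 < tau_theta \<theta>"
    using \<theta> by (simp add: tau_theta_def less_max_iff_disj)
  define d0 where "d0 = admm_d0 f g C D c H G \<beta> \<theta> s\<^sub>0 y\<^sub>0 x\<^sub>0"
  have "0 \<le> d0"
    using admm_d0_greatest[OF A1 bregman_nonneg] by (simp add: d0_def init)
  then have "0 \<le> \<eta> 0" using tau by (simp add: eta_0 d0_def)
  have first: "bregman w (z (Suc 0)) (zt (Suc 0)) + \<eta> (Suc 0) \<le> \<sigma> * bregman w (z 0) (zt (Suc 0)) + \<eta> 0"
  proof -
    let ?r = "bregman w (z (Suc 0)) (zt (Suc 0)) + slack 0 - \<sigma> * bregman w (z 0) (zt (Suc 0))"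
    \<comment> \<open>The infimum \<open>d0\<close> need not be attained. Dividing by the positive
      \<open>tau_theta \<theta>\<close> turns the estimate for each zero into one lower bound for
      all distances, which passes to the infimum.\<close>
    have "?r / tau_theta \<theta> \<le> d0"
      unfolding d0_def init[symmetric]
      using error_condition_first[of _ 0] tau
      by (intro admm_d0_greatest A1) (simp add: pos_divide_le_eq mult.commute diff_le_eq add.commute)
    then show ?thesis
      using tau by (simp add: slack eta_0 d0_def pos_divide_le_eq mult.commute)
  qed
  have step: "bregman w (z (Suc k)) (zt (Suc k)) + \<eta> (Suc k) \<le> \<sigma> * bregman w (z k) (zt (Suc k)) + \<eta> k" for k
    using first error_condition_Suc by (cases k) (simp_all add: slack)
  have "0 < lam \<and> 0 \<le> \<eta> k \<and> gradient (bregman w (z k)) (z (k - 1)) \<in> enlargement T 0 (zt k) \<and>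
      bregman w (z k) (zt k) + \<eta> k \<le> \<sigma> * bregman w (z (k - 1)) (zt k) + \<eta> (k - 1)"
    if "1 \<le> k" "lam = 1" for k :: nat and lam :: real
    using that step slack_nonneg residual_enlargement by (cases k) (auto simp: slack)
  then show ?thesis
    using sigma_theta_nonneg sigma_theta_le_1 \<open>0 \<le> \<eta> 0\<close> unfolding NE_HPE_instance_def z_def[symmetric] zt_def[symmetric]
    by (simp add: z_def[of 0] init)
qed

end
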